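(* Let $V,\Lambda,\mu_s,\mu_o,K>0$ and $w_s>0$ with $V\ge\overline{C}_s:=\frac{w_s}{\mu_s}+2\sqrt{\frac{w_s}{\Lambda\mu_s}}$. With the thresholds $K_F(w_s),K_S(w_s),\underline K_L(w_s),\overline K_L(w_s),\underline K_C(w_s),\overline K_C(w_s)$ defined in the context, incentive coordination is achieved under the on-demand mechanism if and only if $$\max\{K_F(w_s),K_S(w_s),\underline K_L(w_s),\underline K_C(w_s)\}\le K\le\min\{\overline K_L(w_s),\overline K_C(w_s)\},$$ and incentive coordination is achieved under the standard mechanism if and only if $$K\le\min\{K_F(w_s),K_S(w_s),\underline K_L(w_s),\underline K_C(w_s)\}.$$
   Context: Customers arrive at rate $\Lambda$, have types $\theta$ uniform on $[0,1]$, and join service $i$ iff $U_i=V-p_i-\theta W_i\ge0$ ($p_i$ price, $W_i$ lead time). System S (standard mechanism): the service provider (SP) chooses price $p_s$ and number $k_s\ge0$ of employees (service rate $\mu_s$, hourly wage $w_s$); $\lambda_s=\Lambda\Pr(U_s\ge0)$, $W_s=1/(k_s\mu_s-\lambda_s)$ with $k_s\mu_s>\lambda_s$; the SP maximizes $p_s\lambda_s-w_sk_s$ (optimal value $\pi^S$). When $V=\overline{C}_s$, where the optimum is not unique, the optimal policy with $\lambda_s=\Lambda$ is taken. System O (on-demand mechanism): the SP chooses price $p_o$ and per-service wage $w_o$; there is a pool of $K$ contractors (service rate $\mu_o$) with reservation rates $r$ uniform on $[0,1]$, and $\lambda_o=\Lambda\Pr(U_o\ge0)$, $W_o=1/(k_o\mu_o-\lambda_o)$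 with $k_o\mu_o>\lambda_o$, and the number $k_o$ of participating contractors satisfies $k_o=K\Pr(\lambda_ow_o/k_o\ge r)$, where the uniform distribution function is taken to be $x\mapsto x$, i.e. $k_o^2=K\lambda_ow_o$; the SP maximizes $p_o\lambda_o-\lambda_ow_o$ (optimal value $\pi^O$). At the optimal policies: consumer surplus $CS=\Lambda\int_0^1\max\{U_i,0\}\,d\theta$ ($i=s$ for $CS^S$, $i=o$ for $CS^O$); labor welfare $LW^S=k_sw_s-k_s\int_0^{w_s}r\,dr$ and $LW^O=K\int_0^{\lambda_ow_o/k_o}(\frac{\lambda_ow_o}{k_o}-r)\,dr$; social welfare $SW^S=\pi^S+LW^S+CS^S$, $SW^O=\pi^O+LW^O+CS^O$. Thresholds, for fixed $w_s$ (the System S quantities do not depend on $K$, the System O quantities do not depend on $w_s$): $K_F(w_s)=\inf\{K>0:\pi^O\ge\pi^S\}$; $K_S(w_s)=\inf\{K>0:SW^O\ge SW^S\}$; $\underline K_L(w_s)$ and $\overline K_L(w_s)$ are the infimum and supremum of $\{K>0:LW^O\ge LW^S\}$ (both $+\infty$ if this set is empty); $\underline K_C(w_s)$ and $\overline K_C(w_s)$ are the infimum and supremum of $\{K>0:CS^O\ge CS^S\}$. Incentive coordination is achieved under the on-demand mechanism if all parties (SP, labor, consumers, and hence society) are better off under it: $\pi^O\ge\pi^S$, $LW^O\ge LW^S$, $CS^O\ge CS^S$ (and $SW^O\ge SW^S$). It is achieved under the standard mechanism if the reverse (weak) inequalities hold. *)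

theory Defs
  imports "HOL-Analysis.Analysis"
begin

text \<open>
  Throughout, \<open>V\<close> is the service value, \<open>\<Lambda>\<close> the potential arrival rate, \<open>\<mu>\<close> a service rate
  (\<open>\<mu>s\<close> and \<open>\<mu>o\<close> when both systems are involved), \<open>p\<close> a price, \<open>w\<close> a wage, \<open>k\<close> a number of
  active workers, \<open>K\<close> the size of the contractor pool and \<open>a\<close> an effective arrival rate.
\<close>

definition lead_time :: "real \<Rightarrow> real \<Rightarrow> real \<Rightarrow> real" where
  "lead_time \<mu> k a = 1 / (k * \<mu> - a)"

definition utility :: "real \<Rightarrow> real \<Rightarrow> real \<Rightarrow> real \<Rightarrow> real" where
  "utility V p W \<theta> = V - p - \<theta> * W"

definition join_prob :: "real \<Rightarrow> real \<Rightarrow> real \<Rightarrow> real" where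
  "join_prob V p W = measure (uniform_measure lborel {0..1}) {\<theta>. utility V p W \<theta> \<ge> 0}"

text \<open>
  The arrival rate occurs on both sides of this condition, through the lead time;
  policies are therefore represented below together with the arrival rate (and, in the on-demand
  system, the number of participating contractors) that they induce.
\<close>

definition queue_equilibrium :: "real \<Rightarrow> real \<Rightarrow> real \<Rightarrow> real \<Rightarrow> real \<Rightarrow> real \<Rightarrow> bool" where
  "queue_equilibrium V \<Lambda> \<mu> p k a \<longleftrightarrow>
     k * \<mu> > a \<and> a = \<Lambda> * join_prob V p (lead_time \<mu> k a)"

definition consumer_surplus :: "real \<Rightarrow> real \<Rightarrow> real \<Rightarrow> real \<Rightarrow> real \<Rightarrow> real \<Rightarrow> real" where
  "consumer_surplus V \<Lambda> \<mu> p k a =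
     \<Lambda> * integral {0..1} (\<lambda>\<theta>. max (utility V p (lead_time \<mu> k a) \<theta>) 0)"


section \<open>Standard mechanism: policies \<open>(p, k, a)\<close>\<close>

definition C_bar_S :: "real \<Rightarrow> real \<Rightarrow> real \<Rightarrow> real" where
  "C_bar_S \<Lambda> \<mu> w = w / \<mu> + 2 * sqrt (w / (\<Lambda> * \<mu>))"

definition feasible_S :: "real \<Rightarrow> real \<Rightarrow> real \<Rightarrow> (real \<times> real \<times> real) set" where
  "feasible_S V \<Lambda> \<mu> = {(p, k, a). k \<ge> 0 \<and> queue_equilibrium V \<Lambda> \<mu> p k a}"

definition profit_S :: "real \<Rightarrow> real \<times> real \<times> real \<Rightarrow> real" where
  "profit_S w = (\<lambda>(p, k, a). p * a - w * k)"

definition optimal_S :: "real \<Rightarrow> real \<Rightarrow> real \<Rightarrow> real \<Rightarrow> real \<times> real \<times> real \<Rightarrow> bool" where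
  "optimal_S V \<Lambda> \<mu> w x \<longleftrightarrow>
     x \<in> feasible_S V \<Lambda> \<mu> \<and> (\<forall>y \<in> feasible_S V \<Lambda> \<mu>. profit_S w y \<le> profit_S w x)"

text \<open>The second conjunct is the tie-breaking rule in favour of full market coverage.\<close>

definition policy_S :: "real \<Rightarrow> real \<Rightarrow> real \<Rightarrow> real \<Rightarrow> real \<times> real \<times> real" where
  "policy_S V \<Lambda> \<mu> w = (THE (p, k, a).
     optimal_S V \<Lambda> \<mu> w (p, k, a) \<and> (V = C_bar_S \<Lambda> \<mu> w \<longrightarrow> a = \<Lambda>))"

definition pi_S :: "real \<Rightarrow> real \<Rightarrow> real \<Rightarrow> real \<Rightarrow> real" where
  "pi_S V \<Lambda> \<mu> w = profit_S w (policy_S V \<Lambda> \<mu> w)"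

definition CS_S :: "real \<Rightarrow> real \<Rightarrow> real \<Rightarrow> real \<Rightarrow> real" where
  "CS_S V \<Lambda> \<mu> w = (case policy_S V \<Lambda> \<mu> w of (p, k, a) \<Rightarrow> consumer_surplus V \<Lambda> \<mu> p k a)"

definition LW_S :: "real \<Rightarrow> real \<Rightarrow> real \<Rightarrow> real \<Rightarrow> real" where
  "LW_S V \<Lambda> \<mu> w = (case policy_S V \<Lambda> \<mu> w of (p, k, a) \<Rightarrow> k * w - k * integral {0..w} (\<lambda>r. r))"

definition SW_S :: "real \<Rightarrow> real \<Rightarrow> real \<Rightarrow> real \<Rightarrow> real" where
  "SW_S V \<Lambda> \<mu> w = pi_S V \<Lambda> \<mu> w + LW_S V \<Lambda> \<mu> w + CS_S V \<Lambda> \<mu> w"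


section \<open>On-demand mechanism: policies \<open>(p, w, k, a)\<close>\<close>

text \<open>
  Contractors earn \<open>a * w / k\<close> per unit of time; with distribution function \<open>x \<mapsto> x\<close> for the
  reservation rates, participation \<open>k = K * (a * w / k)\<close> is written as \<open>k\<^sup>2 = K * a * w\<close>.
\<close>

definition feasible_O :: "real \<Rightarrow> real \<Rightarrow> real \<Rightarrow> real \<Rightarrow> (real \<times> real \<times> real \<times> real) set" where
  "feasible_O V \<Lambda> \<mu> K = {(p, w, k, a). k \<ge> 0 \<and> k\<^sup>2 = K * a * w \<and> queue_equilibrium V \<Lambda> \<mu> p k a}"

definition profit_O :: "real \<times> real \<times> real \<times> real \<Rightarrow> real" where
  "profit_O = (\<lambda>(p, w, k, a). p * a - a * w)"

definition optimal_O :: "real \<Rightarrow> real \<Rightarrow> real \<Rightarrow> real \<Rightarrow> real \<times> real \<times> real \<times> real \<Rightarrow> bool" where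
  "optimal_O V \<Lambda> \<mu> K x \<longleftrightarrow>
     x \<in> feasible_O V \<Lambda> \<mu> K \<and> (\<forall>y \<in> feasible_O V \<Lambda> \<mu> K. profit_O y \<le> profit_O x)"

definition policy_O :: "real \<Rightarrow> real \<Rightarrow> real \<Rightarrow> real \<Rightarrow> real \<times> real \<times> real \<times> real" where
  "policy_O V \<Lambda> \<mu> K = (THE x. optimal_O V \<Lambda> \<mu> K x)"

definition pi_O :: "real \<Rightarrow> real \<Rightarrow> real \<Rightarrow> real \<Rightarrow> real" where
  "pi_O V \<Lambda> \<mu> K = profit_O (policy_O V \<Lambda> \<mu> K)"

definition CS_O :: "real \<Rightarrow> real \<Rightarrow> real \<Rightarrow> real \<Rightarrow> real" where
  "CS_O V \<Lambda> \<mu> K = (case policy_O V \<Lambda> \<mu> K of (p, w, k, a) \<Rightarrow> consumer_surplus V \<Lambda> \<mu> p k a)"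

definition LW_O :: "real \<Rightarrow> real \<Rightarrow> real \<Rightarrow> real \<Rightarrow> real" where
  "LW_O V \<Lambda> \<mu> K = (case policy_O V \<Lambda> \<mu> K of (p, w, k, a) \<Rightarrow>
     K * integral {0..a * w / k} (\<lambda>r. a * w / k - r))"

definition SW_O :: "real \<Rightarrow> real \<Rightarrow> real \<Rightarrow> real \<Rightarrow> real" where
  "SW_O V \<Lambda> \<mu> K = pi_O V \<Lambda> \<mu> K + LW_O V \<Lambda> \<mu> K + CS_O V \<Lambda> \<mu> K"


section \<open>Thresholds and incentive coordination\<close>

definition K_F :: "real \<Rightarrow> real \<Rightarrow> real \<Rightarrow> real \<Rightarrow> real \<Rightarrow> ereal" where
  "K_F V \<Lambda> \<mu>s \<mu>o ws = Inf (ereal ` {K. K > 0 \<and> pi_O V \<Lambda> \<mu>o K \<ge> pi_S V \<Lambda> \<mu>s ws})"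

definition K_S :: "real \<Rightarrow> real \<Rightarrow> real \<Rightarrow> real \<Rightarrow> real \<Rightarrow> ereal" where
  "K_S V \<Lambda> \<mu>s \<mu>o ws = Inf (ereal ` {K. K > 0 \<and> SW_O V \<Lambda> \<mu>o K \<ge> SW_S V \<Lambda> \<mu>s ws})"

definition labor_better_O :: "real \<Rightarrow> real \<Rightarrow> real \<Rightarrow> real \<Rightarrow> real \<Rightarrow> real set" where
  "labor_better_O V \<Lambda> \<mu>s \<mu>o ws = {K. K > 0 \<and> LW_O V \<Lambda> \<mu>o K \<ge> LW_S V \<Lambda> \<mu>s ws}"

definition K_L_lower :: "real \<Rightarrow> real \<Rightarrow> real \<Rightarrow> real \<Rightarrow> real \<Rightarrow> ereal" where
  "K_L_lower V \<Lambda> \<mu>s \<mu>o ws =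
     (if labor_better_O V \<Lambda> \<mu>s \<mu>o ws = {} then \<infinity>
      else Inf (ereal ` labor_better_O V \<Lambda> \<mu>s \<mu>o ws))"

text \<open>The empty case departs from \<open>Sup {} = -\<infinity>\<close> by convention.\<close>

definition K_L_upper :: "real \<Rightarrow> real \<Rightarrow> real \<Rightarrow> real \<Rightarrow> real \<Rightarrow> ereal" where
  "K_L_upper V \<Lambda> \<mu>s \<mu>o ws =
     (if labor_better_O V \<Lambda> \<mu>s \<mu>o ws = {} then \<infinity>
      else Sup (ereal ` labor_better_O V \<Lambda> \<mu>s \<mu>o ws))"

definition K_C_lower :: "real \<Rightarrow> real \<Rightarrow> real \<Rightarrow> real \<Rightarrow> real \<Rightarrow> ereal" where
  "K_C_lower V \<Lambda> \<mu>s \<mu>o ws = Inf (ereal ` {K. K > 0 \<and> CS_O V \<Lambda> \<mu>o K \<ge> CS_S V \<Lambda> \<mu>s ws})"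

definition K_C_upper :: "real \<Rightarrow> real \<Rightarrow> real \<Rightarrow> real \<Rightarrow> real \<Rightarrow> ereal" where
  "K_C_upper V \<Lambda> \<mu>s \<mu>o ws = Sup (ereal ` {K. K > 0 \<and> CS_O V \<Lambda> \<mu>o K \<ge> CS_S V \<Lambda> \<mu>s ws})"

definition coordination_O :: "real \<Rightarrow> real \<Rightarrow> real \<Rightarrow> real \<Rightarrow> real \<Rightarrow> real \<Rightarrow> bool" where
  "coordination_O V \<Lambda> \<mu>s \<mu>o ws K \<longleftrightarrow>
     pi_O V \<Lambda> \<mu>o K \<ge> pi_S V \<Lambda> \<mu>s ws \<and> LW_O V \<Lambda> \<mu>o K \<ge> LW_S V \<Lambda> \<mu>s ws \<and>
     CS_O V \<Lambda> \<mu>o K \<ge> CS_S V \<Lambda> \<mu>s ws \<and> SW_O V \<Lambda> \<mu>o K \<ge> SW_S V \<Lambda> \<mu>s ws"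

definition coordination_S :: "real \<Rightarrow> real \<Rightarrow> real \<Rightarrow> real \<Rightarrow> real \<Rightarrow> real \<Rightarrow> bool" where
  "coordination_S V \<Lambda> \<mu>s \<mu>o ws K \<longleftrightarrow>
     pi_O V \<Lambda> \<mu>o K \<le> pi_S V \<Lambda> \<mu>s ws \<and> LW_O V \<Lambda> \<mu>o K \<le> LW_S V \<Lambda> \<mu>s ws \<and>
     CS_O V \<Lambda> \<mu>o K \<le> CS_S V \<Lambda> \<mu>s ws \<and> SW_O V \<Lambda> \<mu>o K \<le> SW_S V \<Lambda> \<mu>s ws"

end

theory Submission
  imports Defs
begin

text \<open>
  Describe an on-demand policy by its arrival rate \<open>a\<close> and its slack ratio
  \<open>t = (k * \<mu> - a) / a\<close>. The profit is strictly concave in \<open>a\<close> and the slack, and at its maximum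
  profit, consumer surplus and labor welfare are all of the form \<open>a / \<Lambda> * g t\<close>. Up to a critical
  pool size \<open>t\<close> is constant and \<open>a\<close> is proportional to \<open>K\<close>; beyond it \<open>a = \<Lambda>\<close> and \<open>t\<close> increases
  with \<open>K\<close>. So profit and social welfare increase in \<open>K\<close>, while labor welfare and consumer surplus
  first increase and then decrease, which makes the sets behind the thresholds closed intervals.
  The standard mechanism can be better for all parties only on the increasing branch: under full
  coverage, a consumer surplus no larger than in the standard system forces a strictly larger profit.
\<close>

section \<open>Queue equilibria\<close>

lemma join_prob_eq:
  assumes "W > 0"
  shows "join_prob V p W = max 0 (min 1 ((V - p) / W))"
proof -
  let ?x = "(V - p) / W"
  have "{\<theta>. 0 \<le> V - p - \<theta> * W} = {..?x}"
    using assms by (auto simp: field_simps)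
  then have "join_prob V p W = measure (uniform_measure lborel {0..1}) {..?x}"
    by (simp add: join_prob_def utility_def)
  also have "\<dots> = measure lborel ({0..1} \<inter> {..?x})"
    by (subst measure_uniform_measure) (auto simp: emeasure_lborel_Icc_eq)
  also have "{0..1} \<inter> {..?x} = {0..min 1 ?x}"
    by auto
  finally show ?thesis
    by (simp add: max_def)
qed

text \<open>With slack \<open>s = k * \<mu> - a\<close>, the reciprocal of the lead time, the types
  up to \<open>(V - p) * s\<close> join. The price is only bounded from above: under full coverage
  it may lie below the value at which the last type is indifferent. The bound needs
  \<open>a > 0\<close>, since any sufficiently high price induces \<open>a = 0\<close>.\<close>

lemma queue_equilibriumD:
  assumes "queue_equilibrium V \<Lambda> \<mu> p k a" "\<Lambda> > 0"
  shows "0 \<le> a" "a \<le> \<Lambda>" "k * \<mu> > a" "a > 0 \<Longrightarrow> p \<le> V - a / (\<Lambda> * (k * \<mu> - a))"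
proof -
  define s where "s = k * \<mu> - a"
  have s: "s > 0" and a: "a = \<Lambda> * max 0 (min 1 ((V - p) * s))"
    using assms by (auto simp: queue_equilibrium_def lead_time_def s_def join_prob_eq)
  show "0 \<le> a" "a \<le> \<Lambda>" "k * \<mu> > a"
    using s assms(2) by (subst a, simp, subst a, simp, simp add: s_def)
  assume "a > 0"
  then have "0 < max 0 (min 1 ((V - p) * s))"
    using a assms(2) by (metis zero_less_mult_pos)
  then have "a \<le> \<Lambda> * ((V - p) * s)"
    using assms(2) by (subst a) (auto simp: max_def split: if_splits)
  then show "p \<le> V - a / (\<Lambda> * (k * \<mu> - a))"
    using s assms(2) unfolding s_def[symmetric] by (simp add: field_simps)
qed

text \<open>This price leaves the marginal type \<open>a / \<Lambda>\<close> exactly indifferent, so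
  for \<open>a > 0\<close> it attains the bound in \<open>queue_equilibriumD\<close>. The optimal
  policies of both systems have this form.\<close>

lemma queue_equilibriumI:
  assumes "\<Lambda> > 0" "0 \<le> a" "a \<le> \<Lambda>" "k * \<mu> > a" "p = V - a / (\<Lambda> * (k * \<mu> - a))"
  shows "queue_equilibrium V \<Lambda> \<mu> p k a"
  using assms by (simp add: queue_equilibrium_def lead_time_def join_prob_eq max_def min_def)

text \<open>At the marginal price the utility is \<open>(x - \<theta>) / s\<close> with
  \<open>x = a / \<Lambda>\<close>, so the integral is the area of a triangle with base
  \<open>x\<close> and height \<open>x / s\<close>.\<close>

lemma consumer_surplus_eq:
  assumes "\<Lambda> > 0" "0 \<le> a" "a \<le> \<Lambda>" "k * \<mu> > a" "p = V - a / (\<Lambda> * (k * \<mu> - a))"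
  shows "consumer_surplus V \<Lambda> \<mu> p k a = a\<^sup>2 / (2 * \<Lambda> * (k * \<mu> - a))"
proof -
  define s where "s = k * \<mu> - a"
  have s: "s > 0" using assms by (simp add: s_def)
  define x where "x = a / \<Lambda>"
  have x: "0 \<le> x" "x \<le> 1" using assms by (auto simp: x_def)
  let ?f = "\<lambda>\<theta>. max (utility V p (lead_time \<mu> k a) \<theta>) 0"
  have f: "?f \<theta> = max ((x - \<theta>) / s) 0" for \<theta>
  proof -
    have "p = V - x / s" using assms by (simp add: s_def x_def)
    then show ?thesis
      by (simp add: utility_def lead_time_def diff_divide_distrib flip: s_def)
  qed
  have "((\<lambda>\<theta>. (x - \<theta>) / s) has_integral (x * x - x\<^sup>2 / 2) / s - (x * 0 - 0\<^sup>2 / 2) / s) {0..x}"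
    using x s by (intro fundamental_theorem_of_calculus)
      (auto intro!: derivative_eq_intros simp flip: has_real_derivative_iff_has_vector_derivative)
  moreover have "(x * x - x\<^sup>2 / 2) / s - (x * 0 - 0\<^sup>2 / 2) / s = x\<^sup>2 / (2 * s)"
    using s by (simp add: field_simps power2_eq_square)
  moreover have "(x - \<theta>) / s = ?f \<theta>" if "\<theta> \<in> {0..x}" for \<theta>
    using s that unfolding f by simp
  ultimately have 1: "(?f has_integral x\<^sup>2 / (2 * s)) {0..x}"
    by (metis (no_types, lifting) has_integral_eq)
  have 2: "(?f has_integral 0) {x..1}"
    unfolding f using s by (intro has_integral_is_0) (auto simp: max_def divide_simps)
  have "(?f has_integral x\<^sup>2 / (2 * s) + 0) {0..1}"
    by (rule has_integral_combine[OF x 1 2])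
  then have "integral {0..1} ?f = x\<^sup>2 / (2 * s)"
    by (simp add: integral_unique)
  then show ?thesis
    using s assms(1) by (simp add: consumer_surplus_def x_def s_def field_simps power2_eq_square)
qed

lemma integral_rate_minus:
  assumes "(x::real) \<ge> 0"
  shows "integral {0..x} (\<lambda>r. x - r) = x\<^sup>2 / 2"
proof -
  have "((\<lambda>r. x - r) has_integral (x * x - x\<^sup>2 / 2) - (x * 0 - 0\<^sup>2 / 2)) {0..x}"
    using assms by (intro fundamental_theorem_of_calculus)
      (auto intro!: derivative_eq_intros simp flip: has_real_derivative_iff_has_vector_derivative)
  then show ?thesis by (simp add: integral_unique power2_eq_square)
qed

section \<open>The optimal standard policy\<close>

text \<open>
  With slack \<open>s = k * \<mu> - a\<close>, completing the square in \<open>s\<close> exhibits the profit as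
  \<open>a * (V - C_bar_S)\<close> minus a nonnegative loss.
\<close>

lemma profit_S_bound:
  assumes pos: "\<Lambda> > 0" "\<mu> > 0" "w > 0" and feas: "(p, k, a) \<in> feasible_S V \<Lambda> \<mu>"
    and "a > 0"
  defines "r \<equiv> sqrt (w / (\<Lambda> * \<mu>))" and "s \<equiv> k * \<mu> - a"
  shows "profit_S w (p, k, a) = a * (V - C_bar_S \<Lambda> \<mu> w)
    - \<Lambda> * (a / \<Lambda> - r * s)\<^sup>2 / s - a * (V - a / (\<Lambda> * s) - p)"
proof -
  have s: "s > 0" using feas by (auto simp: feasible_S_def queue_equilibrium_def s_def)
  have r: "w = r * r * \<Lambda> * \<mu>" using pos by (simp add: r_def)
  have k: "k = (a + s) / \<mu>" using pos by (simp add: s_def)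
  show ?thesis
    unfolding C_bar_S_def r_def[symmetric] profit_S_def k
    using pos s by (simp add: r divide_simps) (simp add: algebra_simps power2_eq_square)
qed


text \<open>In \<open>profit_S_bound\<close> the losses vanish exactly when
  \<open>r * s = a / \<Lambda>\<close> and the price is the marginal one, and the remaining
  \<open>a * d\<close> with \<open>d \<ge> 0\<close> is largest at \<open>a = \<Lambda>\<close>.
  Thus \<open>s = 1 / r\<close>, and \<open>r\<close> is the optimal lead time. For
  \<open>d = 0\<close> only the tie-breaking rule singles out \<open>a = \<Lambda>\<close>.\<close>

lemma policy_S_eq:
  assumes pos: "\<Lambda> > 0" "\<mu> > 0" "w > 0" and V: "V \<ge> C_bar_S \<Lambda> \<mu> w"
  defines "r \<equiv> sqrt (w / (\<Lambda> * \<mu>))"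
  shows "policy_S V \<Lambda> \<mu> w = (V - r, (\<Lambda> + 1 / r) / \<mu>, \<Lambda>)"
proof -
  let ?x = "(V - r, (\<Lambda> + 1 / r) / \<mu>, \<Lambda>)"
  define d where "d = V - C_bar_S \<Lambda> \<mu> w"
  have d: "d \<ge> 0" using V by (simp add: d_def)
  have r: "r > 0" using pos by (simp add: r_def)
  have feas: "?x \<in> feasible_S V \<Lambda> \<mu>"
    using pos r by (auto simp: feasible_S_def intro!: queue_equilibriumI)
  have val: "profit_S w ?x = \<Lambda> * d"
    using profit_S_bound[OF pos feas] pos r by (simp add: d_def flip: r_def)
  have bound: "profit_S w (p, k, a) \<le> \<Lambda> * d \<and>
      (profit_S w (p, k, a) = \<Lambda> * d \<longrightarrow> (d = 0 \<longrightarrow> a = \<Lambda>) \<longrightarrow> (p, k, a) = ?x)"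
    if y: "(p, k, a) \<in> feasible_S V \<Lambda> \<mu>" for p k a
  proof -
    define s where "s = k * \<mu> - a"
    have a: "0 \<le> a" "a \<le> \<Lambda>" "s > 0" "a > 0 \<Longrightarrow> p \<le> V - a / (\<Lambda> * s)"
      using queue_equilibriumD[of V \<Lambda> \<mu> p k a] y pos by (auto simp: feasible_S_def s_def)
    show ?thesis
    proof (cases "a = 0")
      case True
      \<comment> \<open>Without customers, stability still forces a positive staff, whose wages make
        the profit negative.\<close>
      then have "k > 0" using a pos by (simp add: s_def zero_less_mult_iff)
      then have "profit_S w (p, k, a) < 0" using True pos by (simp add: profit_S_def)
      moreover have "\<Lambda> * d \<ge> 0" using d pos by simp
      ultimately show ?thesis by linarith
    next
      case False
      with a have a0: "a > 0" by simp
      define e1 where "e1 = \<Lambda> * (a / \<Lambda> - r * s)\<^sup>2 / s"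
      define e2 where "e2 = a * (V - a / (\<Lambda> * s) - p)"
      have e: "e1 \<ge> 0" "e2 \<ge> 0" using a a0 pos by (auto simp: e1_def e2_def)
      have eq: "profit_S w (p, k, a) = a * d - e1 - e2"
        using profit_S_bound[OF pos y a0] by (simp add: e1_def e2_def d_def r_def s_def)
      have le: "a * d \<le> \<Lambda> * d" using a d by (intro mult_right_mono)
      have "(p, k, a) = ?x" if "profit_S w (p, k, a) = \<Lambda> * d" "d = 0 \<longrightarrow> a = \<Lambda>"
      proof -
        \<comment> \<open>The gap to \<open>\<Lambda> * d\<close> is the sum of the three
          nonnegative terms \<open>(\<Lambda> - a) * d\<close>, \<open>e1\<close> and
          \<open>e2\<close>, so equality kills each of them.\<close>
        have "e1 = 0" "e2 = 0" "a * d = \<Lambda> * d" using that(1) eq e le by linarith+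
        then have "a = \<Lambda>" "r * s = a / \<Lambda>" "p = V - a / (\<Lambda> * s)"
          using that a a0 pos by (auto simp: e1_def e2_def)
        moreover from this have "s = 1 / r" using r pos by (simp add: field_simps)
        moreover have "k = (a + s) / \<mu>" using pos by (simp add: s_def)
        ultimately show ?thesis using r pos by simp
      qed
      moreover have "profit_S w (p, k, a) \<le> \<Lambda> * d" using eq e le by linarith
      ultimately show ?thesis by blast
    qed
  qed
  have opt: "optimal_S V \<Lambda> \<mu> w ?x"
    unfolding optimal_S_def val using feas bound by fast
  show ?thesis
    unfolding policy_S_def
  proof (rule the_equality)
    show "case ?x of (p, k, a) \<Rightarrow> optimal_S V \<Lambda> \<mu> w (p, k, a) \<and> (V = C_bar_S \<Lambda> \<mu> w \<longrightarrow> a = \<Lambda>)"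
      using opt by simp
  next
    fix y assume y: "case y of (p, k, a) \<Rightarrow> optimal_S V \<Lambda> \<mu> w (p, k, a) \<and> (V = C_bar_S \<Lambda> \<mu> w \<longrightarrow> a = \<Lambda>)"
    obtain p k a where [simp]: "y = (p, k, a)" by (cases y)
    have "(p, k, a) \<in> feasible_S V \<Lambda> \<mu>" "\<Lambda> * d \<le> profit_S w (p, k, a)" "d = 0 \<longrightarrow> a = \<Lambda>"
      using y feas val by (auto simp: optimal_S_def d_def)
    then show "y = ?x" using bound[of p k a] by force
  qed
qed

lemma standard_values:
  assumes "\<Lambda> > 0" "\<mu> > 0" "w > 0" "V \<ge> C_bar_S \<Lambda> \<mu> w"
  shows "pi_S V \<Lambda> \<mu> w = \<Lambda> * (V - C_bar_S \<Lambda> \<mu> w)"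
    and "CS_S V \<Lambda> \<mu> w = \<Lambda> * sqrt (w / (\<Lambda> * \<mu>)) / 2"
proof -
  define r where "r = sqrt (w / (\<Lambda> * \<mu>))"
  have r: "r > 0" "w = r * r * \<Lambda> * \<mu>" using assms by (simp_all add: r_def)
  note pol = policy_S_eq[OF assms, folded r_def]
  show "pi_S V \<Lambda> \<mu> w = \<Lambda> * (V - C_bar_S \<Lambda> \<mu> w)"
    unfolding pi_S_def pol C_bar_S_def r_def[symmetric] profit_S_def
    using r assms by (simp add: field_simps)
  show "CS_S V \<Lambda> \<mu> w = \<Lambda> * sqrt (w / (\<Lambda> * \<mu>)) / 2"
    unfolding CS_S_def pol r_def[symmetric]
    using r assms by (simp add: consumer_surplus_eq power2_eq_square)
qed

section \<open>The optimal on-demand policy\<close>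

text \<open>
  The first two terms are the tangent plane of the profit, as a concave function of \<open>a\<close> and of the slack
  \<open>s = k * \<mu> - a\<close>, at the point \<open>a = b\<close>, \<open>s = b * t\<close>; the condition relating \<open>b\<close> and \<open>t\<close> says
  that the derivative in \<open>s\<close> vanishes there.
\<close>

lemma profit_O_bound:
  assumes pos: "\<Lambda> > 0" "\<mu> > 0" "K > 0" "t > 0"
    and bt: "2 * \<Lambda> * b * t\<^sup>2 * (1 + t) = K * \<mu>\<^sup>2"
    and feas: "(p, w, k, a) \<in> feasible_O V \<Lambda> \<mu> K"
  defines "s \<equiv> k * \<mu> - a"
  shows "profit_O (p, w, k, a) =
    a * (V - 2 / (\<Lambda> * t) - 1 / (\<Lambda> * t\<^sup>2)) + b * (1 + t) / (2 * \<Lambda> * t\<^sup>2)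
    - (a - s / t)\<^sup>2 / (\<Lambda> * s) - (a + s - b * (1 + t))\<^sup>2 / (K * \<mu>\<^sup>2)
    - a * (V - a / (\<Lambda> * s) - p)"
proof -
  define M where "M = K * \<mu>\<^sup>2"
  have M: "M > 0" using pos by (simp add: M_def)
  have s: "s > 0" using feas by (auto simp: feasible_O_def queue_equilibrium_def s_def)
  have k: "k\<^sup>2 = K * a * w" using feas by (auto simp: feasible_O_def)
  \<comment> \<open>Participation eliminates the wage: the wage bill \<open>a * w\<close> becomes a
    convex quadratic in the capacity \<open>a + s\<close>.\<close>
  have "(a + s)\<^sup>2 = k\<^sup>2 * \<mu>\<^sup>2" by (simp add: s_def power_mult_distrib)
  then have aw: "a * w = (a + s)\<^sup>2 / M"
    using pos by (simp add: k M_def)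
  \<comment> \<open>First-order condition in the slack: the marginal wage bill at capacity
    \<open>b * (1 + t)\<close> equals the marginal revenue from a shorter lead time on the ray
    \<open>s = a * t\<close>.\<close>
  have foc: "2 * (b * (1 + t)) / M = 1 / (\<Lambda> * t\<^sup>2)"
    using M pos unfolding bt[folded M_def, symmetric] by (simp add: field_simps)
  \<comment> \<open>This square and the one in fact \<open>2\<close> are the gaps between a convex
    cost and its tangent: first the wage bill, then the waiting cost
    \<open>a\<^sup>2 / (\<Lambda> * s)\<close>.\<close>
  have "(a + s - b * (1 + t))\<^sup>2 / M =
      (a + s)\<^sup>2 / M - (a + s - b * (1 + t) / 2) * (2 * (b * (1 + t)) / M)"
    using M by (simp add: field_simps) (simp add: power2_eq_square algebra_simps)
  then have 1: "(a + s - b * (1 + t))\<^sup>2 / M =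
      (a + s)\<^sup>2 / M - (a + s - b * (1 + t) / 2) / (\<Lambda> * t\<^sup>2)"
    by (simp add: foc)
  have 2: "(a - s / t)\<^sup>2 / (\<Lambda> * s) = a\<^sup>2 / (\<Lambda> * s) - 2 * a / (\<Lambda> * t) + s / (\<Lambda> * t\<^sup>2)"
    using pos s by (simp add: divide_simps) (simp add: power2_eq_square algebra_simps)
  show ?thesis
    unfolding profit_O_def M_def[symmetric] 1 2 prod.case aw
    by (simp add: algebra_simps power2_eq_square diff_divide_distrib add_divide_distrib)
qed

text \<open>The assumptions are the optimality conditions of a concave problem. The slope
  \<open>c\<close> of the tangent plane in \<open>a\<close> is nonnegative, and it is zero unless
  the constraint \<open>a \<le> \<Lambda>\<close> binds at \<open>b\<close>. The squared losses then
  make the maximizer unique, so that \<open>THE\<close> is justified.\<close>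

lemma policy_O_eq:
  assumes pos: "\<Lambda> > 0" "\<mu> > 0" "K > 0" "t > 0" and b: "0 < b" "b \<le> \<Lambda>"
    and bt: "2 * \<Lambda> * b * t\<^sup>2 * (1 + t) = K * \<mu>\<^sup>2"
    and t: "\<Lambda> * V * t\<^sup>2 \<ge> 1 + 2 * t" "b = \<Lambda> \<or> \<Lambda> * V * t\<^sup>2 = 1 + 2 * t"
  shows "policy_O V \<Lambda> \<mu> K = (V - 1 / (\<Lambda> * t), b * (1 + t)\<^sup>2 / (K * \<mu>\<^sup>2), b * (1 + t) / \<mu>, b)"
proof -
  let ?x = "(V - 1 / (\<Lambda> * t), b * (1 + t)\<^sup>2 / (K * \<mu>\<^sup>2), b * (1 + t) / \<mu>, b)"
  define c where "c = V - 2 / (\<Lambda> * t) - 1 / (\<Lambda> * t\<^sup>2)"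
  have c_eq: "c = (\<Lambda> * V * t\<^sup>2 - (1 + 2 * t)) / (\<Lambda> * t\<^sup>2)"
    using pos by (simp add: c_def field_simps power2_eq_square)
  have c: "c \<ge> 0" "b = \<Lambda> \<or> c = 0"
    using pos t by (auto simp: c_eq)
  define v where "v = b * c + b * (1 + t) / (2 * \<Lambda> * t\<^sup>2)"
  have feas: "?x \<in> feasible_O V \<Lambda> \<mu> K"
    using pos b by (auto simp: feasible_O_def power_divide power_mult_distrib field_simps
      power2_eq_square intro!: queue_equilibriumI)
  have slack: "b * (1 + t) / \<mu> * \<mu> - b = b * t"
    using pos by (simp add: field_simps)
  have val: "profit_O ?x = v"
    unfolding profit_O_bound[OF pos bt feas] slack
    using pos b by (simp add: v_def c_def field_simps)
  have bound: "profit_O (p, w, k, a) \<le> v \<and> (profit_O (p, w, k, a) = v \<longrightarrow> (p, w, k, a) = ?x)"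
    if y: "(p, w, k, a) \<in> feasible_O V \<Lambda> \<mu> K" for p w k a
  proof -
    define s where "s = k * \<mu> - a"
    have a: "0 \<le> a" "a \<le> \<Lambda>" "s > 0" "a > 0 \<Longrightarrow> p \<le> V - a / (\<Lambda> * s)"
      using queue_equilibriumD[of V \<Lambda> \<mu> p k a] y pos by (auto simp: feasible_O_def s_def)
    have k: "k\<^sup>2 = K * a * w" using y by (auto simp: feasible_O_def)
    \<comment> \<open>Without customers nobody earns anything, so \<open>k = 0\<close> and the queue
      cannot be stable.\<close>
    have a0: "a > 0"
    proof (rule ccontr)
      assume "\<not> a > 0"
      then have "a = 0" using a by simp
      then have "k = 0" using k by simp
      with \<open>a = 0\<close> a show False by (simp add: s_def)
    qed
    define e1 where "e1 = (a - s / t)\<^sup>2 / (\<Lambda> * s)"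
    define e2 where "e2 = (a + s - b * (1 + t))\<^sup>2 / (K * \<mu>\<^sup>2)"
    define e3 where "e3 = a * (V - a / (\<Lambda> * s) - p)"
    have e: "e1 \<ge> 0" "e2 \<ge> 0" "e3 \<ge> 0" using a a0 pos by (auto simp: e1_def e2_def e3_def)
    have eq: "profit_O (p, w, k, a) = a * c + b * (1 + t) / (2 * \<Lambda> * t\<^sup>2) - e1 - e2 - e3"
      using profit_O_bound[OF pos bt y] by (simp add: e1_def e2_def e3_def c_def s_def)
    have le: "a * c \<le> b * c" using a c by (auto intro: mult_right_mono)
    have "(p, w, k, a) = ?x" if "profit_O (p, w, k, a) = v"
    proof -
      have "e1 = 0" "e2 = 0" "e3 = 0" using that eq e le by (auto simp: v_def)
      \<comment> \<open>The ray \<open>a = s / t\<close> and the line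
        \<open>a + s = b * (1 + t)\<close> meet in a single point, which determines \<open>a\<close>
        and \<open>s\<close>.\<close>
      then have *: "a = s / t" "a + s = b * (1 + t)" "p = V - a / (\<Lambda> * s)"
        using a a0 pos by (auto simp: e1_def e2_def e3_def)
      have st: "s = a * t" using pos by (simp add: *(1))
      then have "a * (1 + t) = b * (1 + t)" using *(2) by (simp add: st algebra_simps)
      then have ab: "a = b" using pos by simp
      have keq: "k = b * (1 + t) / \<mu>" using pos st ab by (simp add: s_def field_simps)
      have "w = k\<^sup>2 / (K * b)" using k pos b ab by simp
      also have "\<dots> = b * (1 + t)\<^sup>2 / (K * \<mu>\<^sup>2)"
        using pos b by (simp add: keq power2_eq_square mult_ac)
      finally show ?thesis using * ab keq st b pos by simp
    qed
    moreover have "profit_O (p, w, k, a) \<le> v" using eq e le unfolding v_def by linarith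
    ultimately show ?thesis by blast
  qed
  show ?thesis
    unfolding policy_O_def
  proof (rule the_equality)
    show "optimal_O V \<Lambda> \<mu> K ?x"
      unfolding optimal_O_def val using feas bound by fast
  next
    fix y assume y: "optimal_O V \<Lambda> \<mu> K y"
    obtain p w k a where [simp]: "y = (p, w, k, a)" by (metis prod_cases4)
    have "(p, w, k, a) \<in> feasible_O V \<Lambda> \<mu> K" "v \<le> profit_O (p, w, k, a)"
      using y feas val by (auto simp: optimal_O_def)
    then show "y = ?x" using bound[of p w k a] by force
  qed
qed

section \<open>Thresholds of superlevel sets\<close>

text \<open>If \<open>f K < c\<close>, continuity keeps \<open>f\<close> below \<open>c\<close> on a
  neighbourhood of \<open>K\<close>. If moreover no smaller point reaches \<open>c\<close>, the
  whole superlevel set stays a distance \<open>d\<close> above \<open>K\<close>. The empty set, with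
  infimum \<open>\<infinity>\<close>, is included.\<close>

lemma superlevel_Inf_leD:
  fixes f :: "real \<Rightarrow> real"
  assumes f: "continuous_on {0<..} f" and K: "K > 0"
    and le: "Inf (ereal ` {x. x > 0 \<and> c \<le> f x}) \<le> ereal K"
  shows "c \<le> f K \<or> (\<exists>x. 0 < x \<and> x < K \<and> c \<le> f x)"
proof (rule ccontr)
  assume *: "\<not> ?thesis"
  then have fK: "f K < c" by auto
  have "isCont f K" using f K by (auto simp: continuous_on_eq_continuous_at)
  then have "eventually (\<lambda>x. f x < c) (at K)"
    using fK by (auto simp: isCont_def order_tendsto_iff)
  then obtain d where d: "d > 0" "\<And>x. x \<noteq> K \<Longrightarrow> dist x K < d \<Longrightarrow> f x < c"
    by (auto simp: eventually_at)
  have "ereal (K + d) \<le> Inf (ereal ` {x. x > 0 \<and> c \<le> f x})"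
  proof (rule Inf_greatest, clarsimp)
    fix x assume x: "0 < x" "c \<le> f x"
    then have "x > K" using * fK by (metis linorder_neqE_linordered_idom not_less)
    then show "K + d \<le> x" using d(2)[of x] x by (force simp: dist_real_def)
  qed
  also note le
  finally show False using d by simp
qed

lemma superlevel_le_SupD:
  fixes f :: "real \<Rightarrow> real"
  assumes f: "continuous_on {0<..} f" and K: "K > 0"
    and le: "ereal K \<le> Sup (ereal ` {x. x > 0 \<and> c \<le> f x})"
  shows "c \<le> f K \<or> (\<exists>x>K. c \<le> f x)"
proof (rule ccontr)
  assume *: "\<not> ?thesis"
  then have fK: "f K < c" by auto
  have "isCont f K" using f K by (auto simp: continuous_on_eq_continuous_at)
  then have "eventually (\<lambda>x. f x < c) (at K)"
    using fK by (auto simp: isCont_def order_tendsto_iff)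
  then obtain d where d: "d > 0" "\<And>x. x \<noteq> K \<Longrightarrow> dist x K < d \<Longrightarrow> f x < c"
    by (auto simp: eventually_at)
  note le
  also have "Sup (ereal ` {x. x > 0 \<and> c \<le> f x}) \<le> ereal (K - d)"
  proof (rule Sup_least, clarsimp)
    fix x assume x: "0 < x" "c \<le> f x"
    then have "x < K" using * fK by (metis linorder_neqE_linordered_idom not_less)
    then show "x \<le> K - d" using d(2)[of x] x by (force simp: dist_real_def)
  qed
  finally show False using d by simp
qed

text \<open>If \<open>f K > c\<close>, continuity also puts points slightly left of \<open>K\<close>
  into the set.\<close>

lemma le_superlevel_InfD:
  fixes f :: "real \<Rightarrow> real"
  assumes f: "continuous_on {0<..} f" and K: "K > 0"
    and le: "ereal K \<le> Inf (ereal ` {x. x > 0 \<and> c \<le> f x})"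
  shows "f K \<le> c"
proof (rule ccontr)
  assume fK: "\<not> ?thesis"
  have "isCont f K" using f K by (auto simp: continuous_on_eq_continuous_at)
  then have "eventually (\<lambda>x. f x > c) (at K)"
    using fK by (auto simp: isCont_def order_tendsto_iff)
  then obtain d where d: "d > 0" "\<And>x. x \<noteq> K \<Longrightarrow> dist x K < d \<Longrightarrow> c < f x"
    by (auto simp: eventually_at)
  \<comment> \<open>The maximum with \<open>K / 2\<close> keeps the witness positive.\<close>
  define x where "x = max (K / 2) (K - d / 2)"
  have x: "0 < x" "x < K" "dist x K < d" using K d(1) by (auto simp: x_def dist_real_def)
  then have "ereal x \<in> ereal ` {x. x > 0 \<and> c \<le> f x}" using d(2)[of x] by auto
  then have "Inf (ereal ` {x. x > 0 \<and> c \<le> f x}) \<le> ereal x" by (rule Inf_lower)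
  with le have "ereal K \<le> ereal x" by (rule order_trans)
  then show False using x by simp
qed

text \<open>Strict monotonicity excludes an earlier point at the same level when
  \<open>f K = c\<close>. It serves only the direction from \<open>f K \<le> c\<close>; the other
  one is continuity alone.\<close>

lemma le_superlevel_Inf_iff:
  fixes f :: "real \<Rightarrow> real"
  assumes f: "continuous_on {0<..} f" and K: "K > 0"
    and inc: "f K \<le> c \<Longrightarrow> strict_mono_on {0<..K} f"
  shows "ereal K \<le> Inf (ereal ` {x. x > 0 \<and> c \<le> f x}) \<longleftrightarrow> f K \<le> c"
proof
  assume "f K \<le> c"
  show "ereal K \<le> Inf (ereal ` {x. x > 0 \<and> c \<le> f x})"
  proof (rule Inf_greatest, clarsimp)
    fix x assume x: "0 < x" "c \<le> f x"
    show "K \<le> x"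
    proof (rule ccontr)
      assume "\<not> K \<le> x"
      then have "f x < f K" using x inc[OF \<open>f K \<le> c\<close>] by (auto intro: strict_mono_onD)
      then show False using x \<open>f K \<le> c\<close> by simp
    qed
  qed
qed (rule le_superlevel_InfD[OF f K])

lemma superlevel_Inf_le_iff:
  fixes f :: "real \<Rightarrow> real"
  assumes f: "continuous_on {0<..} f" and K: "K > 0" and inc: "mono_on {0<..} f"
  shows "Inf (ereal ` {x. x > 0 \<and> c \<le> f x}) \<le> ereal K \<longleftrightarrow> c \<le> f K"
proof
  assume "Inf (ereal ` {x. x > 0 \<and> c \<le> f x}) \<le> ereal K"
  from superlevel_Inf_leD[OF f K this] show "c \<le> f K"
  proof
    assume "\<exists>x. 0 < x \<and> x < K \<and> c \<le> f x"
    then obtain x where "0 < x" "x < K" "c \<le> f x" by blast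
    then show ?thesis using mono_onD[OF inc, of x K] by simp
  qed
qed (use K in \<open>auto intro!: Inf_lower\<close>)

text \<open>A quasiconcave function cannot dip below \<open>c\<close> at \<open>K\<close> between
  two points that reach \<open>c\<close>, so lower and upper threshold together describe the
  superlevel set.\<close>

lemma superlevel_between_iff:
  fixes f :: "real \<Rightarrow> real"
  assumes f: "continuous_on {0<..} f" and K: "K > 0"
    and qc: "\<And>x y. 0 < x \<Longrightarrow> x < K \<Longrightarrow> K < y \<Longrightarrow> min (f x) (f y) \<le> f K"
  shows "Inf (ereal ` {x. x > 0 \<and> c \<le> f x}) \<le> ereal K \<and>
    ereal K \<le> Sup (ereal ` {x. x > 0 \<and> c \<le> f x}) \<longleftrightarrow> c \<le> f K"
proof
  assume *: "Inf (ereal ` {x. x > 0 \<and> c \<le> f x}) \<le> ereal K \<and>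
    ereal K \<le> Sup (ereal ` {x. x > 0 \<and> c \<le> f x})"
  show "c \<le> f K"
  proof (rule ccontr)
    assume "\<not> c \<le> f K"
    then obtain x y where "0 < x" "x < K" "c \<le> f x" "K < y" "c \<le> f y"
      using superlevel_Inf_leD[OF f K, of c] superlevel_le_SupD[OF f K, of c] * by blast
    then show False using qc[of x y] \<open>\<not> c \<le> f K\<close> by simp
  qed
qed (use K in \<open>auto intro!: Inf_lower Sup_upper\<close>)

section \<open>Dependence on the pool size\<close>

lemma cubic_strict_mono: "strict_mono_on {0<..} (\<lambda>t::real. t\<^sup>2 * (1 + t))"
  by (intro strict_mono_onI mult_strict_mono power_strict_mono) auto

lemma cubic_image: "(\<lambda>t::real. t\<^sup>2 * (1 + t)) ` {0<..} = {0<..}"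
proof (intro equalityI subsetI)
  fix N :: real assume "N \<in> {0<..}"
  then have N: "N > 0" by simp
  \<comment> \<open>The point \<open>1 + N\<close> is an upper bracket for the intermediate value
    theorem.\<close>
  have "N \<le> (1 + N)\<^sup>2 * (1 + (1 + N))"
    using N by (simp add: power2_eq_square algebra_simps add_nonneg_nonneg)
  then have "\<exists>t. 0 \<le> t \<and> t \<le> 1 + N \<and> t\<^sup>2 * (1 + t) = N"
    using N by (intro IVT') (auto intro!: continuous_intros)
  then obtain t where t: "0 \<le> t" "t\<^sup>2 * (1 + t) = N" by blast
  then have "t > 0" using N by (cases "t = 0") auto
  with t show "N \<in> (\<lambda>t::real. t\<^sup>2 * (1 + t)) ` {0<..}" by auto
qed auto

definition cubic_root :: "real \<Rightarrow> real" where
  "cubic_root = inv_into {0<..} (\<lambda>t. t\<^sup>2 * (1 + t))"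

lemma cubic_root:
  assumes "N > 0"
  shows "cubic_root N > 0" "(cubic_root N)\<^sup>2 * (1 + cubic_root N) = N"
  using inv_into_into[of N "\<lambda>t::real. t\<^sup>2 * (1 + t)" "{0<..}"]
    f_inv_into_f[of N "\<lambda>t::real. t\<^sup>2 * (1 + t)" "{0<..}"] assms
  by (auto simp: cubic_root_def cubic_image)

lemma cubic_root_le_iff:
  assumes "N > 0" "t > 0"
  shows "cubic_root N \<le> t \<longleftrightarrow> N \<le> t\<^sup>2 * (1 + t)"
  using strict_mono_on_less_eq[OF cubic_strict_mono, of "cubic_root N" t] cubic_root[OF assms(1)] assms
  by simp

lemma cubic_root_mono: "mono_on {0<..} cubic_root"
  by (rule mono_onI) (use cubic_root in \<open>auto simp: cubic_root_le_iff\<close>)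

text \<open>A monotone function with open image has no jumps. The image is \<open>{0<..}\<close>
  because every positive \<open>t\<close> is the root for its own cubic value.\<close>

lemma continuous_on_cubic_root: "continuous_on {0<..} cubic_root"
proof (rule continuous_onI_mono)
  have "cubic_root ` {0<..} = {0<..}"
  proof (intro equalityI subsetI)
    fix t :: real assume "t \<in> {0<..}"
    moreover from this have "cubic_root (t\<^sup>2 * (1 + t)) = t"
      unfolding cubic_root_def
      by (intro inv_into_f_f strict_mono_on_imp_inj_on cubic_strict_mono)
    ultimately show "t \<in> cubic_root ` {0<..}"
      by (intro image_eqI[of _ _ "t\<^sup>2 * (1 + t)"]) auto
  qed (auto intro: cubic_root)
  then show "open (cubic_root ` {0<..})" by simp
qed (use mono_onD[OF cubic_root_mono] in auto)

text \<open>Up to \<open>K0\<close> the argument of \<open>g\<close> is frozen at \<open>t0\<close>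
  and \<open>f\<close> is linear in \<open>K\<close>; beyond \<open>K0\<close> it equals
  \<open>g (T K)\<close>. A decreasing nonnegative \<open>g\<close> therefore gives a quasiconcave
  \<open>f\<close>: compare \<open>f K\<close> with \<open>f x\<close> on the first branch and with
  \<open>f y\<close> on the second.\<close>

lemma
  fixes T g :: "real \<Rightarrow> real" and t0 K0 :: real
  assumes T: "continuous_on {0<..} T" "mono_on {0<..} T"
    and K0: "K0 > 0" "\<And>K. K > 0 \<Longrightarrow> T K \<le> t0 \<longleftrightarrow> K \<le> K0"
  defines "f \<equiv> \<lambda>K. min 1 (K / K0) * g (max (T K) t0)"
  shows continuous_on_profile:
      "continuous_on {t0..} g \<Longrightarrow> continuous_on {0<..} f"
    and strict_mono_on_profile:
      "g t0 > 0 \<Longrightarrow> K \<le> K0 \<Longrightarrow> strict_mono_on {0<..K} f"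
    and mono_on_profile:
      "mono_on {t0..} g \<Longrightarrow> g t0 \<ge> 0 \<Longrightarrow> mono_on {0<..} f"
    and quasiconcave_profile:
      "antimono_on {t0..} g \<Longrightarrow> (\<And>t. t \<ge> t0 \<Longrightarrow> g t \<ge> 0) \<Longrightarrow>
        0 < x \<Longrightarrow> x < K \<Longrightarrow> K < y \<Longrightarrow> min (f x) (f y) \<le> f K"
proof -
  have low: "f x = x / K0 * g t0" if "0 < x" "x \<le> K0" for x
    using that K0 by (simp add: f_def max_def)
  have high: "f x = g (T x)" "T x > t0" if "x > K0" for x
    using that K0 by (auto simp: f_def max_def simp flip: not_le)
  show "continuous_on {0<..} f" if "continuous_on {t0..} g"
    unfolding f_def using K0(1)
    by (intro continuous_on_mult continuous_on_compose2[OF that] continuous_intros T) auto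
  show "strict_mono_on {0<..K} f" if "g t0 > 0" "K \<le> K0"
    by (intro strict_mono_onI) (use that K0(1) in \<open>auto simp: low divide_strict_right_mono\<close>)
  show "mono_on {0<..} f" if g: "mono_on {t0..} g" "g t0 \<ge> 0"
  proof (rule mono_onI)
    fix x y :: real assume xy: "x \<in> {0<..}" "y \<in> {0<..}" "x \<le> y"
    have 1: "t0 \<le> max (T x) t0" "max (T x) t0 \<le> max (T y) t0"
      using mono_onD[OF T(2) xy] by auto
    have "0 \<le> g (max (T x) t0)"
      using mono_onD[OF g(1), of t0 "max (T x) t0"] g(2) by auto
    moreover have "g (max (T x) t0) \<le> g (max (T y) t0)"
      using 1 by (intro mono_onD[OF g(1)]) auto
    ultimately show "f x \<le> f y"
      unfolding f_def using xy K0(1)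
      by (intro mult_mono min.mono divide_right_mono) auto
  qed
  show "min (f x) (f y) \<le> f K"
    if g: "antimono_on {t0..} g" "\<And>t. t \<ge> t0 \<Longrightarrow> g t \<ge> 0" and x: "0 < x" "x < K" "K < y"
  proof (cases "K \<le> K0")
    case True
    then have "f x \<le> f K"
      using x g(2)[of t0] K0(1) by (auto simp: low intro!: mult_right_mono divide_right_mono)
    then show ?thesis by simp
  next
    case False
    then have "T K \<le> T y" "t0 \<le> T K"
      using x K0(1) high(2)[of K] mono_onD[OF T(2), of K y] by auto
    then have "g (T y) \<le> g (T K)"
      using monotone_onD[OF g(1), of "T K" "T y"] by auto
    then show ?thesis using False x by (simp add: high)
  qed
qed

text \<open>
  \<open>slack_floor\<close> is the positive root of \<open>\<Lambda> * V * t\<^sup>2 = 1 + 2 * t\<close>, the slack ratio \<open>t = s / a\<close>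
  that is optimal as long as the market is not fully covered; \<open>full_pool\<close> is the pool size at
  which coverage becomes full.
\<close>

definition slack_floor :: "real \<Rightarrow> real \<Rightarrow> real" where
  "slack_floor V \<Lambda> = (1 + sqrt (1 + \<Lambda> * V)) / (\<Lambda> * V)"

definition full_pool :: "real \<Rightarrow> real \<Rightarrow> real \<Rightarrow> real" where
  "full_pool V \<Lambda> \<mu> = 2 * \<Lambda>\<^sup>2 / \<mu>\<^sup>2 * ((slack_floor V \<Lambda>)\<^sup>2 * (1 + slack_floor V \<Lambda>))"

text \<open>The solution \<open>t\<close> of the first-order condition in \<open>policy_O_eq\<close>
  with \<open>b = \<Lambda>\<close>.\<close>

definition covered_slack :: "real \<Rightarrow> real \<Rightarrow> real \<Rightarrow> real" where
  "covered_slack \<Lambda> \<mu> K = cubic_root (K * \<mu>\<^sup>2 / (2 * \<Lambda>\<^sup>2))"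

lemma slack_floor:
  assumes "V > 0" "\<Lambda> > 0"
  shows "slack_floor V \<Lambda> > 0" "\<Lambda> * V * (slack_floor V \<Lambda>)\<^sup>2 = 1 + 2 * slack_floor V \<Lambda>"
proof -
  define v where "v = \<Lambda> * V"
  have v: "v > 0" using assms by (simp add: v_def)
  define q where "q = sqrt (1 + v)"
  have q: "q > 0" "v = q * q - 1" using v by (auto simp: q_def)
  have eq: "slack_floor V \<Lambda> = (1 + q) / v"
    by (simp add: slack_floor_def q_def v_def)
  then show "slack_floor V \<Lambda> > 0" using v q(1) by simp
  have "v * ((1 + q) / v)\<^sup>2 = (1 + q)\<^sup>2 / v"
    using v by (simp add: power2_eq_square)
  also have "\<dots> = 1 + 2 * ((1 + q) / v)"
    using v q(2) by (simp add: field_simps power2_eq_square)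
  finally show "\<Lambda> * V * (slack_floor V \<Lambda>)\<^sup>2 = 1 + 2 * slack_floor V \<Lambda>"
    by (simp add: eq v_def)
qed

lemma full_pool_pos:
  assumes "V > 0" "\<Lambda> > 0" "\<mu> > 0"
  shows "full_pool V \<Lambda> \<mu> > 0"
  using slack_floor(1)[OF assms(1,2)] assms by (simp add: full_pool_def)

text \<open>\<open>full_pool\<close> is the pool size at which the cubic takes its value at
  \<open>slack_floor\<close>, so by monotonicity the two regimes meet there.\<close>

lemma covered_slack_le_iff:
  assumes "V > 0" "\<Lambda> > 0" "\<mu> > 0" "K > 0"
  shows "covered_slack \<Lambda> \<mu> K \<le> slack_floor V \<Lambda> \<longleftrightarrow> K \<le> full_pool V \<Lambda> \<mu>"
proof -
  have "covered_slack \<Lambda> \<mu> K \<le> slack_floor V \<Lambda> \<longleftrightarrow>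
    K * \<mu>\<^sup>2 / (2 * \<Lambda>\<^sup>2) \<le> (slack_floor V \<Lambda>)\<^sup>2 * (1 + slack_floor V \<Lambda>)"
    unfolding covered_slack_def
    using assms slack_floor(1)[OF assms(1,2)] by (intro cubic_root_le_iff) auto
  also have "\<dots> \<longleftrightarrow> K \<le> full_pool V \<Lambda> \<mu>"
    unfolding full_pool_def using assms by (simp add: field_simps)
  finally show ?thesis .
qed

lemma covered_slack_mono:
  assumes "\<Lambda> > 0" "\<mu> > 0"
  shows "mono_on {0<..} (covered_slack \<Lambda> \<mu>)"
  unfolding covered_slack_def
  by (rule mono_onI, rule mono_onD[OF cubic_root_mono])
    (use assms in \<open>auto simp: divide_right_mono mult_right_mono\<close>)

lemma continuous_on_covered_slack:
  assumes "\<Lambda> > 0" "\<mu> > 0"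
  shows "continuous_on {0<..} (covered_slack \<Lambda> \<mu>)"
  unfolding covered_slack_def
  by (intro continuous_on_compose2[OF continuous_on_cubic_root] continuous_intros)
    (use assms in auto)

text \<open>The first factor is the market coverage \<open>a / \<Lambda>\<close> at the optimum, and
  the argument of \<open>g\<close> is the optimal slack ratio; \<open>min\<close> and
  \<open>max\<close> join the two regimes.\<close>

definition profile_O :: "real \<Rightarrow> real \<Rightarrow> real \<Rightarrow> (real \<Rightarrow> real) \<Rightarrow> real \<Rightarrow> real" where
  "profile_O V \<Lambda> \<mu> g K =
    min 1 (K / full_pool V \<Lambda> \<mu>) * g (max (covered_slack \<Lambda> \<mu> K) (slack_floor V \<Lambda>))"

lemma
  assumes "V > 0" "\<Lambda> > 0" "\<mu> > 0"
  shows continuous_on_profile_O: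
      "continuous_on {slack_floor V \<Lambda>..} g \<Longrightarrow> continuous_on {0<..} (profile_O V \<Lambda> \<mu> g)"
    and strict_mono_on_profile_O:
      "g (slack_floor V \<Lambda>) > 0 \<Longrightarrow> K \<le> full_pool V \<Lambda> \<mu> \<Longrightarrow>
        strict_mono_on {0<..K} (profile_O V \<Lambda> \<mu> g)"
    and mono_on_profile_O:
      "mono_on {slack_floor V \<Lambda>..} g \<Longrightarrow> g (slack_floor V \<Lambda>) \<ge> 0 \<Longrightarrow>
        mono_on {0<..} (profile_O V \<Lambda> \<mu> g)"
    and quasiconcave_profile_O:
      "antimono_on {slack_floor V \<Lambda>..} g \<Longrightarrow> (\<And>t. t \<ge> slack_floor V \<Lambda> \<Longrightarrow> g t \<ge> 0) \<Longrightarrow>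
        0 < x \<Longrightarrow> x < K \<Longrightarrow> K < y \<Longrightarrow>
        min (profile_O V \<Lambda> \<mu> g x) (profile_O V \<Lambda> \<mu> g y) \<le> profile_O V \<Lambda> \<mu> g K"
proof -
  have eq: "profile_O V \<Lambda> \<mu> g = (\<lambda>K. min 1 (K / full_pool V \<Lambda> \<mu>) *
      g (max (covered_slack \<Lambda> \<mu> K) (slack_floor V \<Lambda>)))"
    by (rule ext) (rule profile_O_def)
  note prem = continuous_on_covered_slack[OF assms(2,3)] covered_slack_mono[OF assms(2,3)]
    full_pool_pos[OF assms] covered_slack_le_iff[OF assms]
  show "continuous_on {slack_floor V \<Lambda>..} g \<Longrightarrow> continuous_on {0<..} (profile_O V \<Lambda> \<mu> g)"
    unfolding eq by (rule continuous_on_profile[OF prem])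
  show "g (slack_floor V \<Lambda>) > 0 \<Longrightarrow> K \<le> full_pool V \<Lambda> \<mu> \<Longrightarrow>
      strict_mono_on {0<..K} (profile_O V \<Lambda> \<mu> g)"
    unfolding eq by (rule strict_mono_on_profile[OF prem])
  show "mono_on {slack_floor V \<Lambda>..} g \<Longrightarrow> g (slack_floor V \<Lambda>) \<ge> 0 \<Longrightarrow>
      mono_on {0<..} (profile_O V \<Lambda> \<mu> g)"
    unfolding eq by (rule mono_on_profile[OF prem])
  show "antimono_on {slack_floor V \<Lambda>..} g \<Longrightarrow> (\<And>t. t \<ge> slack_floor V \<Lambda> \<Longrightarrow> g t \<ge> 0) \<Longrightarrow>
      0 < x \<Longrightarrow> x < K \<Longrightarrow> K < y \<Longrightarrow>
      min (profile_O V \<Lambda> \<mu> g x) (profile_O V \<Lambda> \<mu> g y) \<le> profile_O V \<Lambda> \<mu> g K"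
    unfolding eq by (rule quasiconcave_profile[OF prem])
qed

section \<open>Closed forms of the on-demand quantities\<close>

lemma on_demand_values:
  assumes pos: "V > 0" "\<Lambda> > 0" "\<mu> > 0" "K > 0"
  shows "pi_O V \<Lambda> \<mu> K = profile_O V \<Lambda> \<mu> (\<lambda>t. \<Lambda> * V - 3 / (2 * t) - 1 / (2 * t\<^sup>2)) K"
    and "CS_O V \<Lambda> \<mu> K = profile_O V \<Lambda> \<mu> (\<lambda>t. 1 / (2 * t)) K"
    and "LW_O V \<Lambda> \<mu> K = profile_O V \<Lambda> \<mu> (\<lambda>t. (1 + t) / (4 * t\<^sup>2)) K"
proof -
  define t0 where "t0 = slack_floor V \<Lambda>"
  define K0 where "K0 = full_pool V \<Lambda> \<mu>"
  define T where "T = covered_slack \<Lambda> \<mu> K"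
  define t where "t = max T t0"
  define b where "b = \<Lambda> * min 1 (K / K0)"
  have t0: "t0 > 0" "\<Lambda> * V * t0\<^sup>2 = 1 + 2 * t0"
    using slack_floor pos by (auto simp: t0_def)
  have K0: "K0 > 0" "K0 * \<mu>\<^sup>2 = 2 * \<Lambda>\<^sup>2 * (t0\<^sup>2 * (1 + t0))"
    using full_pool_pos pos by (auto simp: K0_def full_pool_def t0_def)
  have T: "T > 0" "T\<^sup>2 * (1 + T) = K * \<mu>\<^sup>2 / (2 * \<Lambda>\<^sup>2)"
    unfolding T_def covered_slack_def using pos by (auto intro: cubic_root)
  have TK: "T \<le> t0 \<longleftrightarrow> K \<le> K0"
    using covered_slack_le_iff pos by (simp add: T_def t0_def K0_def)
  have t: "t > 0" using T by (simp add: t_def)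
  have b: "0 < b" "b \<le> \<Lambda>" using pos K0 by (auto simp: b_def)
  \<comment> \<open>With partial coverage \<open>b\<close> absorbs the change in \<open>K\<close>
    while \<open>t\<close> stays at \<open>t0\<close>; with full coverage
    \<open>b = \<Lambda>\<close> and \<open>t\<close> solves the cubic.\<close>
  have bt: "2 * \<Lambda> * b * t\<^sup>2 * (1 + t) = K * \<mu>\<^sup>2"
  proof (cases "K \<le> K0")
    case True
    then have "t = t0" "b = \<Lambda> * K / K0" using TK K0 by (auto simp: t_def b_def)
    then have "2 * \<Lambda> * b * t\<^sup>2 * (1 + t) = K / K0 * (2 * \<Lambda>\<^sup>2 * (t0\<^sup>2 * (1 + t0)))"
      by (simp add: power2_eq_square)
    also have "\<dots> = K * \<mu>\<^sup>2" using K0 by (simp flip: K0(2))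
    finally show ?thesis .
  next
    case False
    then have "t = T" "b = \<Lambda>" using TK K0 by (auto simp: t_def b_def)
    then have "2 * \<Lambda> * b * t\<^sup>2 * (1 + t) = 2 * \<Lambda>\<^sup>2 * (T\<^sup>2 * (1 + T))"
      by (simp add: power2_eq_square)
    also have "\<dots> = K * \<mu>\<^sup>2" unfolding T(2) using pos by simp
    finally show ?thesis .
  qed
  \<comment> \<open>Equality holds at \<open>t0\<close>, and \<open>2 / t + 1 / t\<^sup>2\<close>
    decreases in \<open>t\<close>.\<close>
  have "\<Lambda> * V - 2 / t \<ge> 1 / t\<^sup>2"
  proof -
    have "1 / t\<^sup>2 \<le> 1 / t0\<^sup>2" "2 / t \<le> 2 / t0"
      using t0 by (auto simp: t_def intro!: divide_left_mono power_mono)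
    moreover have "\<Lambda> * V = 1 / t0\<^sup>2 + 2 / t0"
      using t0 by (simp add: field_simps power2_eq_square)
    ultimately show ?thesis by linarith
  qed
  then have ge: "\<Lambda> * V * t\<^sup>2 \<ge> 1 + 2 * t"
    using t by (simp add: field_simps power2_eq_square)
  have or: "b = \<Lambda> \<or> \<Lambda> * V * t\<^sup>2 = 1 + 2 * t"
    using TK t0(2) K0 by (cases "K \<le> K0") (auto simp: t_def b_def)
  note pol = policy_O_eq[OF pos(2-4) t b bt ge or]
  have K\<mu>: "K * \<mu>\<^sup>2 > 0" using pos by simp
  have slack: "b * (1 + t) / \<mu> * \<mu> - b = b * t"
    using pos by (simp add: field_simps)
  have prof: "profile_O V \<Lambda> \<mu> g K = b / \<Lambda> * g t" for g
    using pos by (simp add: profile_O_def b_def t_def T_def t0_def K0_def)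
  \<comment> \<open>By \<open>bt\<close> the pool size cancels from the optimal wage, which leaves a
    function of \<open>t\<close> alone.\<close>
  have ratio: "b * (1 + t)\<^sup>2 / (K * \<mu>\<^sup>2) = (1 + t) / (2 * \<Lambda> * t\<^sup>2)"
    unfolding bt[symmetric] using pos t b by (simp add: power2_eq_square)
  show "pi_O V \<Lambda> \<mu> K = profile_O V \<Lambda> \<mu> (\<lambda>t. \<Lambda> * V - 3 / (2 * t) - 1 / (2 * t\<^sup>2)) K"
    unfolding pi_O_def pol prof ratio profit_O_def
    using pos t b by (simp add: field_simps power2_eq_square)
  show "CS_O V \<Lambda> \<mu> K = profile_O V \<Lambda> \<mu> (\<lambda>t. 1 / (2 * t)) K"
    unfolding CS_O_def pol prof prod.case
    using pos t b by (subst consumer_surplus_eq) (simp_all add: slack power2_eq_square, simp_all add: field_simps)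
  have rate: "b * (b * (1 + t)\<^sup>2 / (K * \<mu>\<^sup>2)) / (b * (1 + t) / \<mu>) = b * (1 + t) / (K * \<mu>)"
    using pos t b by (simp add: power2_eq_square)
  have "LW_O V \<Lambda> \<mu> K = K * ((b * (1 + t) / (K * \<mu>))\<^sup>2 / 2)"
    unfolding LW_O_def pol prod.case rate
    using pos t b by (subst integral_rate_minus) auto
  also have "\<dots> = b / 2 * (b * (1 + t)\<^sup>2 / (K * \<mu>\<^sup>2))"
    using pos by (simp add: power2_eq_square mult_ac)
  also have "\<dots> = b / \<Lambda> * ((1 + t) / (4 * t\<^sup>2))"
    unfolding ratio by simp
  finally show "LW_O V \<Lambda> \<mu> K = profile_O V \<Lambda> \<mu> (\<lambda>t. (1 + t) / (4 * t\<^sup>2)) K"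
    unfolding prof .
qed

text \<open>The three summands share the coverage factor, so their sum is again a profile.\<close>

lemma SW_O_eq:
  assumes "V > 0" "\<Lambda> > 0" "\<mu> > 0" "K > 0"
  shows "SW_O V \<Lambda> \<mu> K = profile_O V \<Lambda> \<mu> (\<lambda>t. \<Lambda> * V - 3 / (4 * t) - 1 / (4 * t\<^sup>2)) K"
proof -
  define t where "t = max (covered_slack \<Lambda> \<mu> K) (slack_floor V \<Lambda>)"
  have "t > 0" using slack_floor(1)[of V \<Lambda>] assms by (simp add: t_def less_max_iff_disj)
  then have eq: "(\<Lambda> * V - 3 / (2 * t) - 1 / (2 * t\<^sup>2)) + (1 + t) / (4 * t\<^sup>2) + 1 / (2 * t) =
      \<Lambda> * V - 3 / (4 * t) - 1 / (4 * t\<^sup>2)"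
    by (simp add: field_simps power2_eq_square)
  then show ?thesis
    unfolding SW_O_def on_demand_values[OF assms] profile_O_def t_def[symmetric]
    by (simp only: distrib_left[symmetric] eq)
qed

section \<open>Incentive coordination\<close>

text \<open>Under full coverage both systems are governed by one number: consumer surplus is
  \<open>z / 2\<close> and \<open>y / 2\<close>, while profit is \<open>\<Lambda> * V\<close> minus
  \<open>3 / 2 * z + z * z / 2\<close> and minus \<open>y * y + 2 * y\<close>. For
  \<open>0 < z \<le> y\<close> the on-demand loss is strictly smaller.\<close>

lemma pi_O_gt_pi_S:
  assumes pos: "V > 0" "\<Lambda> > 0" "\<mu>s > 0" "\<mu>o > 0" "K > 0" "w > 0" and V: "V \<ge> C_bar_S \<Lambda> \<mu>s w"
    and K: "K > full_pool V \<Lambda> \<mu>o" and CS: "CS_O V \<Lambda> \<mu>o K \<le> CS_S V \<Lambda> \<mu>s w"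
  shows "pi_S V \<Lambda> \<mu>s w < pi_O V \<Lambda> \<mu>o K"
proof -
  define t where "t = covered_slack \<Lambda> \<mu>o K"
  define z where "z = 1 / t"
  define y where "y = \<Lambda> * sqrt (w / (\<Lambda> * \<mu>s))"
  have t: "t > slack_floor V \<Lambda>"
    using covered_slack_le_iff[of V \<Lambda> \<mu>o K] pos K by (simp add: t_def)
  have "full_pool V \<Lambda> \<mu>o > 0" using pos by (intro full_pool_pos)
  then have prof: "profile_O V \<Lambda> \<mu>o g K = g t" for g
    using t K by (simp add: profile_O_def flip: t_def)
  have z: "z > 0" using t slack_floor(1)[of V \<Lambda>] pos by (simp add: z_def)
  have "z \<le> y"
    using CS standard_values(2)[of \<Lambda> \<mu>s w V] pos V
    by (simp add: on_demand_values prof y_def z_def)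
  then have "z * z \<le> y * y" using z by (intro mult_mono) auto
  have "y\<^sup>2 = \<Lambda>\<^sup>2 * (w / (\<Lambda> * \<mu>s))"
    using pos by (simp add: y_def power_mult_distrib)
  then have y2: "y * y = \<Lambda> * (w / \<mu>s)"
    using pos by (simp add: power2_eq_square)
  have "pi_S V \<Lambda> \<mu>s w = \<Lambda> * V - (y * y + 2 * y)"
    using standard_values(1)[of \<Lambda> \<mu>s w V] pos V
    by (simp add: C_bar_S_def y2) (simp add: y_def algebra_simps)
  also have "\<dots> < \<Lambda> * V - (3 / 2 * z + z * z / 2)"
    using \<open>z \<le> y\<close> \<open>z * z \<le> y * y\<close> z mult_pos_pos[OF z z] by linarith
  also have "\<dots> = pi_O V \<Lambda> \<mu>o K"
    using pos by (simp add: on_demand_values prof z_def power2_eq_square)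
  finally show ?thesis .
qed

lemma Max_le_four: "Max {a, b, c, d} \<le> z \<longleftrightarrow> a \<le> z \<and> b \<le> z \<and> c \<le> z \<and> d \<le> z"
  and Min_ge_four: "z \<le> Min {a, b, c, d} \<longleftrightarrow> z \<le> a \<and> z \<le> b \<and> z \<le> c \<and> z \<le> d"
  and Min_ge_two: "z \<le> Min {a, b} \<longleftrightarrow> z \<le> a \<and> z \<le> b"
  for a b c d z :: "'a :: linorder"
  by (simp_all only: Max_le_iff Min_ge_iff finite.intros insert_not_empty ball_simps simp_thms)

theorem corollary2:
  fixes V \<Lambda> \<mu>s \<mu>o K ws :: real
  assumes "V > 0" and "\<Lambda> > 0" and "\<mu>s > 0" and "\<mu>o > 0" and "K > 0" and "ws > 0"
    and "V \<ge> C_bar_S \<Lambda> \<mu>s ws"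
  shows "(coordination_O V \<Lambda> \<mu>s \<mu>o ws K \<longleftrightarrow>
            Max {K_F V \<Lambda> \<mu>s \<mu>o ws, K_S V \<Lambda> \<mu>s \<mu>o ws,
                 K_L_lower V \<Lambda> \<mu>s \<mu>o ws, K_C_lower V \<Lambda> \<mu>s \<mu>o ws} \<le> ereal K \<and>
            ereal K \<le> Min {K_L_upper V \<Lambda> \<mu>s \<mu>o ws, K_C_upper V \<Lambda> \<mu>s \<mu>o ws}) \<and>
         (coordination_S V \<Lambda> \<mu>s \<mu>o ws K \<longleftrightarrow>
            ereal K \<le> Min {K_F V \<Lambda> \<mu>s \<mu>o ws, K_S V \<Lambda> \<mu>s \<mu>o ws,
                            K_L_lower V \<Lambda> \<mu>s \<mu>o ws, K_C_lower V \<Lambda> \<mu>s \<mu>o ws})"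
proof -
  note pos = \<open>V > 0\<close> \<open>\<Lambda> > 0\<close> \<open>\<mu>o > 0\<close>
  define t0 where "t0 = slack_floor V \<Lambda>"
  have t0: "t0 > 0" and V_eq: "\<Lambda> * V = 1 / t0\<^sup>2 + 2 / t0"
    using slack_floor[OF pos(1,2)] by (auto simp: t0_def field_simps power2_eq_square)
  define gF where "gF = (\<lambda>t. \<Lambda> * V - 3 / (2 * t) - 1 / (2 * t\<^sup>2))"
  define gS where "gS = (\<lambda>t. \<Lambda> * V - 3 / (4 * t) - 1 / (4 * t\<^sup>2))"
  define gC where "gC = (\<lambda>t::real. 1 / (2 * t))"
  define gL where "gL = (\<lambda>t::real. (1 + t) / (4 * t\<^sup>2))"
  note g_defs = gF_def gS_def gC_def gL_def
  \<comment> \<open>Eliminating \<open>V\<close> through the equation for \<open>t0\<close> makes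
    positivity at the floor visible.\<close>
  have "gF t0 = 1 / (2 * t0\<^sup>2) + 1 / (2 * t0)" "gS t0 = 3 / (4 * t0\<^sup>2) + 5 / (4 * t0)"
    unfolding g_defs V_eq by simp_all
  then have gpos: "gF t0 > 0" "gS t0 > 0" "gC t0 > 0" "gL t0 > 0"
    using t0 by (auto simp: gC_def gL_def add_pos_pos)
  have gcont: "continuous_on {t0..} gF" "continuous_on {t0..} gS"
      "continuous_on {t0..} gC" "continuous_on {t0..} gL"
    unfolding g_defs using t0 by (auto intro!: continuous_intros)
  \<comment> \<open>All four functions are affine in \<open>1 / t\<close> and
    \<open>1 / t\<^sup>2\<close>, so their monotonicity reduces to these two inequalities.\<close>
  have inv: "1 / y \<le> 1 / x" "1 / y\<^sup>2 \<le> 1 / x\<^sup>2" if "t0 \<le> x" "x \<le> y" for x y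
    using that t0 by (auto intro!: divide_left_mono power_mono)
  have g_alt: "gF t = \<Lambda> * V - 3 / 2 * (1 / t) - 1 / 2 * (1 / t\<^sup>2)"
      "gS t = \<Lambda> * V - 3 / 4 * (1 / t) - 1 / 4 * (1 / t\<^sup>2)" "gC t = 1 / 2 * (1 / t)" for t
    by (simp_all add: g_defs)
  have gL_alt: "gL t = 1 / 4 * (1 / t\<^sup>2) + 1 / 4 * (1 / t)" if "t \<ge> t0" for t
    using that t0 by (simp add: gL_def field_simps power2_eq_square)
  have g_le: "gF x \<le> gF y \<and> gS x \<le> gS y \<and> gC y \<le> gC x \<and> gL y \<le> gL x"
    if "t0 \<le> x" "x \<le> y" for x y
    using inv[OF that] that unfolding g_alt gL_alt[OF that(1)] gL_alt[OF order_trans[OF that]]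
    by linarith
  have gmono: "mono_on {t0..} gF" "mono_on {t0..} gS"
    by (rule mono_onI; use g_le in simp)+
  have ganti: "antimono_on {t0..} gC" "antimono_on {t0..} gL"
    by (rule monotone_onI; use g_le in simp)+
  have gnn: "\<forall>t\<ge>t0. gC t \<ge> 0" "\<forall>t\<ge>t0. gL t \<ge> 0"
    using t0 by (auto simp: g_defs)
  have eqs: "pi_O V \<Lambda> \<mu>o x = profile_O V \<Lambda> \<mu>o gF x" "SW_O V \<Lambda> \<mu>o x = profile_O V \<Lambda> \<mu>o gS x"
      "CS_O V \<Lambda> \<mu>o x = profile_O V \<Lambda> \<mu>o gC x" "LW_O V \<Lambda> \<mu>o x = profile_O V \<Lambda> \<mu>o gL x"
    if "x > 0" for x
    using on_demand_values[OF pos that] SW_O_eq[OF pos that] by (auto simp: g_defs)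
  note cont = continuous_on_profile_O[OF pos, folded t0_def]
  note smono = strict_mono_on_profile_O[OF pos, folded t0_def]
  note mono = mono_on_profile_O[OF pos, folded t0_def]
  note quasi = quasiconcave_profile_O[OF pos, folded t0_def]
  define cF where "cF = pi_S V \<Lambda> \<mu>s ws"
  define cS where "cS = SW_S V \<Lambda> \<mu>s ws"
  define cC where "cC = CS_S V \<Lambda> \<mu>s ws"
  define cL where "cL = LW_S V \<Lambda> \<mu>s ws"
  let ?S = "\<lambda>g c. ereal ` {x. x > 0 \<and> c \<le> profile_O V \<Lambda> \<mu>o g x}"
  have KF: "K_F V \<Lambda> \<mu>s \<mu>o ws = Inf (?S gF cF)"
    unfolding K_F_def cF_def using eqs(1) by (metis (mono_tags, lifting))
  have KS: "K_S V \<Lambda> \<mu>s \<mu>o ws = Inf (?S gS cS)"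
    unfolding K_S_def cS_def using eqs(2) by (metis (mono_tags, lifting))
  have KC: "K_C_lower V \<Lambda> \<mu>s \<mu>o ws = Inf (?S gC cC)" "K_C_upper V \<Lambda> \<mu>s \<mu>o ws = Sup (?S gC cC)"
    unfolding K_C_lower_def K_C_upper_def cC_def using eqs(3) by (metis (mono_tags, lifting))+
  have L: "labor_better_O V \<Lambda> \<mu>s \<mu>o ws = {x. x > 0 \<and> cL \<le> profile_O V \<Lambda> \<mu>o gL x}"
    unfolding labor_better_O_def cL_def using eqs(4) by (metis (mono_tags, lifting))
  \<comment> \<open>For the lower threshold the default \<open>\<infinity>\<close> agrees with the
    infimum of the empty set. For the upper one the default differs from the supremum, but
    \<open>Inf \<le> ereal K\<close> already makes the set nonempty.\<close>
  have KL: "K_L_lower V \<Lambda> \<mu>s \<mu>o ws = Inf (?S gL cL)"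
    "Inf (?S gL cL) \<le> ereal K \<Longrightarrow> K_L_upper V \<Lambda> \<mu>s \<mu>o ws = Sup (?S gL cL)"
    unfolding K_L_lower_def K_L_upper_def L
    by (cases "{x. x > 0 \<and> cL \<le> profile_O V \<Lambda> \<mu>o gL x} = {}";
        simp only: if_True if_False image_empty Inf_empty top_ereal_def; simp)+
  show ?thesis
  proof (intro conjI)
    have "Inf (?S g c) \<le> ereal K \<longleftrightarrow> c \<le> profile_O V \<Lambda> \<mu>o g K"
      if "continuous_on {t0..} g" "mono_on {t0..} g" "g t0 > 0" for g c
      by (rule superlevel_Inf_le_iff[OF cont[OF that(1)] \<open>K > 0\<close> mono[OF that(2) less_imp_le[OF that(3)]]])
    note FS = this[OF gcont(1) gmono(1) gpos(1), of cF] this[OF gcont(2) gmono(2) gpos(2), of cS]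
    have "Inf (?S g c) \<le> ereal K \<and> ereal K \<le> Sup (?S g c) \<longleftrightarrow> c \<le> profile_O V \<Lambda> \<mu>o g K"
      if "continuous_on {t0..} g" "antimono_on {t0..} g" "\<forall>t\<ge>t0. g t \<ge> 0" for g c
      by (rule superlevel_between_iff[OF cont[OF that(1)] \<open>K > 0\<close> quasi[OF that(2)]])
        (use that(3) in blast)+
    note CL = this[OF gcont(3) ganti(1) gnn(1), of cC] this[OF gcont(4) ganti(2) gnn(2), of cL]
    have "Max {K_F V \<Lambda> \<mu>s \<mu>o ws, K_S V \<Lambda> \<mu>s \<mu>o ws,
                 K_L_lower V \<Lambda> \<mu>s \<mu>o ws, K_C_lower V \<Lambda> \<mu>s \<mu>o ws} \<le> ereal K \<and>
            ereal K \<le> Min {K_L_upper V \<Lambda> \<mu>s \<mu>o ws, K_C_upper V \<Lambda> \<mu>s \<mu>o ws} \<longleftrightarrow>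
        Inf (?S gF cF) \<le> ereal K \<and> Inf (?S gS cS) \<le> ereal K \<and>
        (Inf (?S gL cL) \<le> ereal K \<and> ereal K \<le> Sup (?S gL cL)) \<and>
        (Inf (?S gC cC) \<le> ereal K \<and> ereal K \<le> Sup (?S gC cC))" (is "?r \<longleftrightarrow> _")
    \<comment> \<open>If the lower labor threshold exceeds \<open>K\<close>, both sides are false,
      whatever value \<open>K_L_upper\<close> takes.\<close>
    proof (cases "Inf (?S gL cL) \<le> ereal K")
      case True
      show ?thesis unfolding KF KS KC KL(1) KL(2)[OF True] Max_le_four Min_ge_two by blast
    next
      case False
      then show ?thesis unfolding KL(1) Max_le_four by blast
    qed
    also have "\<dots> \<longleftrightarrow> coordination_O V \<Lambda> \<mu>s \<mu>o ws K"
      unfolding FS CL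
      unfolding coordination_O_def eqs[OF \<open>K > 0\<close>] cF_def cS_def cC_def cL_def by blast
    finally show "coordination_O V \<Lambda> \<mu>s \<mu>o ws K \<longleftrightarrow> ?r" by (rule sym)
  next
    \<comment> \<open>Coordination under the standard mechanism confines \<open>K\<close> to the
      branch where all four profiles increase strictly, so that the lower thresholds suffice even
      for labor and consumers.\<close>
    have small: "K \<le> full_pool V \<Lambda> \<mu>o" if "coordination_S V \<Lambda> \<mu>s \<mu>o ws K"
    proof (rule ccontr)
      assume "\<not> K \<le> full_pool V \<Lambda> \<mu>o"
      then have "K > full_pool V \<Lambda> \<mu>o" by simp
      moreover have "CS_O V \<Lambda> \<mu>o K \<le> CS_S V \<Lambda> \<mu>s ws" "pi_O V \<Lambda> \<mu>o K \<le> pi_S V \<Lambda> \<mu>s ws"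
        using that by (simp_all only: coordination_S_def)
      ultimately show False using pi_O_gt_pi_S[OF assms] by (meson not_less)
    qed
    \<comment> \<open>From thresholds to coordination, continuity at \<open>K\<close> is enough, so
      no knowledge of the branch enters.\<close>
    have ge: "ereal K \<le> Inf (?S g c) \<Longrightarrow> profile_O V \<Lambda> \<mu>o g K \<le> c" if "continuous_on {t0..} g" for g c
      by (rule le_superlevel_InfD[OF cont[OF that] \<open>K > 0\<close>])
    have le: "ereal K \<le> Inf (?S g c)"
      if "coordination_S V \<Lambda> \<mu>s \<mu>o ws K" "continuous_on {t0..} g" "g t0 > 0"
        "profile_O V \<Lambda> \<mu>o g K \<le> c" for g c
      by (rule iffD2[OF le_superlevel_Inf_iff[OF cont[OF that(2)] \<open>K > 0\<close>] that(4)])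
        (rule smono[where g = g, OF that(3) small[OF that(1)]])
    show "coordination_S V \<Lambda> \<mu>s \<mu>o ws K \<longleftrightarrow>
            ereal K \<le> Min {K_F V \<Lambda> \<mu>s \<mu>o ws, K_S V \<Lambda> \<mu>s \<mu>o ws,
                            K_L_lower V \<Lambda> \<mu>s \<mu>o ws, K_C_lower V \<Lambda> \<mu>s \<mu>o ws}" (is "?l \<longleftrightarrow> ?r")
    proof
      assume l: ?l
      then have better: "profile_O V \<Lambda> \<mu>o gF K \<le> cF" "profile_O V \<Lambda> \<mu>o gS K \<le> cS"
          "profile_O V \<Lambda> \<mu>o gC K \<le> cC" "profile_O V \<Lambda> \<mu>o gL K \<le> cL"
        unfolding coordination_S_def eqs[OF \<open>K > 0\<close>] cF_def cS_def cC_def cL_def by blast+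
      then show ?r
        unfolding KF KS KC KL(1) Min_ge_four
        using le[OF l gcont(1) gpos(1) better(1)] le[OF l gcont(2) gpos(2) better(2)]
          le[OF l gcont(3) gpos(3) better(3)] le[OF l gcont(4) gpos(4) better(4)] by (intro conjI)
    next
      assume ?r
      then show ?l
        unfolding coordination_S_def eqs[OF \<open>K > 0\<close>] KF KS KC KL(1) Min_ge_four
          cF_def[symmetric] cS_def[symmetric] cC_def[symmetric] cL_def[symmetric]
        using ge[OF gcont(1), of cF] ge[OF gcont(2), of cS] ge[OF gcont(3), of cC]
          ge[OF gcont(4), of cL] by blast
    qed
  qed
qed

end
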